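(* For every positive integer $n$, \[ \mathrm{MOF}(K_n) \geq \frac{3n-9}{4}. \]
   Context: An orientation of a simple graph $G$ assigns to each edge $\{u,v\}$ exactly one of the arcs $(u,v)$ or $(v,u)$; if $(u,v)$ is an arc, $v$ is an out-neighbor of $u$. Oriented forcing: given an orientation $D$ and a set $S$ of initially colored vertices, any colored vertex having at most $1$ non-colored out-neighbor forces that out-neighbor to become colored; this rule is applied iteratively as long as possible. $S$ is a forcing set of $D$ if at the end every vertex is colored. $F(D)$ is the minimum size of a forcing set of $D$, and $\mathrm{MOF}(G)$ is the maximum of $F(D)$ over all orientations $D$ of $G$. $K_n$ is the complete graph on $n$ vertices. *)

theory Defs
  imports Complex_Main "Graph_Theory.Kuratowski"
begin

text \<open>
  A finite simple graph is a \<^locale>\<open>pair_graph\<close>: each edge \<open>{u, v}\<close> is represented by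
  both pairs \<open>(u, v)\<close> and \<open>(v, u)\<close>. An orientation keeps exactly one of them.
\<close>

definition orientation_of :: "'a pair_pre_digraph \<Rightarrow> 'a pair_pre_digraph \<Rightarrow> bool" where
  "orientation_of D G \<longleftrightarrow>
     pverts D = pverts G \<and> parcs D \<subseteq> parcs G \<and>
     (\<forall>(u, v) \<in> parcs G. ((u, v) \<in> parcs D) \<noteq> ((v, u) \<in> parcs D))"

definition uncolored_out_nbrs :: "'a pair_pre_digraph \<Rightarrow> 'a set \<Rightarrow> 'a \<Rightarrow> 'a set" where
  "uncolored_out_nbrs D C u = {v. (u, v) \<in> parcs D \<and> v \<notin> C}"

text \<open>
  A single application of the rule. A colored vertex without uncolored out-neighbors
  forces nothing, so only the case of exactly one uncolored out-neighbor gives a step.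
\<close>

inductive forcing_step :: "'a pair_pre_digraph \<Rightarrow> 'a set \<Rightarrow> 'a set \<Rightarrow> bool" for D where
  "u \<in> C \<Longrightarrow> uncolored_out_nbrs D C u = {v} \<Longrightarrow> forcing_step D C (insert v C)"

definition final_coloring :: "'a pair_pre_digraph \<Rightarrow> 'a set \<Rightarrow> 'a set \<Rightarrow> bool" where
  "final_coloring D S C \<longleftrightarrow> (forcing_step D)\<^sup>*\<^sup>* S C \<and> (\<nexists>C'. forcing_step D C C')"

text \<open>The final coloring does not depend on the order in which vertices are forced.\<close>

lemma forcing_steps_subset_final:
  assumes "(forcing_step D)\<^sup>*\<^sup>* S X" "final_coloring D S C"
  shows "X \<subseteq> C"
  using assms(1)
proof (induction rule: rtranclp_induct)
  case base
  have "(forcing_step D)\<^sup>*\<^sup>* S C"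
    using assms(2) by (simp add: final_coloring_def)
  then show ?case
    by (induction rule: rtranclp_induct) (auto elim: forcing_step.cases)
next
  case (step Y Z)
  from step.hyps(2) obtain u v
    where u: "u \<in> Y" "uncolored_out_nbrs D Y u = {v}" "Z = insert v Y"
    by (auto elim: forcing_step.cases)
  have "v \<in> C"
  proof (rule ccontr)
    assume "v \<notin> C"
    then have "uncolored_out_nbrs D C u = {v}"
      using u(2) step.IH by (auto simp: uncolored_out_nbrs_def)
    then have "forcing_step D C (insert v C)"
      using u(1) step.IH by (auto intro: forcing_step.intros)
    then show False
      using assms(2) by (auto simp: final_coloring_def)
  qed
  then show ?case using u step.IH by simp
qed

lemma final_coloring_unique:
  "final_coloring D S C \<Longrightarrow> final_coloring D S C' \<Longrightarrow> C = C'"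
  by (meson final_coloring_def forcing_steps_subset_final subset_antisym)

definition forcing_set :: "'a pair_pre_digraph \<Rightarrow> 'a set \<Rightarrow> bool" where
  "forcing_set D S \<longleftrightarrow> S \<subseteq> pverts D \<and> final_coloring D S (pverts D)"

definition forcing_number :: "'a pair_pre_digraph \<Rightarrow> nat" where
  "forcing_number D = Min (card ` {S. forcing_set D S})"

definition MOF :: "'a pair_pre_digraph \<Rightarrow> nat" where
  "MOF G = Max (forcing_number ` {D. orientation_of D G})"

text \<open>
  For a finite simple graph, the sets under \<^const>\<open>Min\<close> and \<^const>\<open>Max\<close> above are
  finite and nonempty.
\<close>

lemma finite_forcing_sets:
  "finite (pverts D) \<Longrightarrow> finite {S. forcing_set D S}"
  by (rule finite_subset[of _ "Pow (pverts D)"]) (auto simp: forcing_set_def)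

lemma forcing_set_pverts:
  assumes "pair_wf_digraph D"
  shows "forcing_set D (pverts D)"
proof -
  have "uncolored_out_nbrs D (pverts D) u = {}" for u
    using pair_wf_digraph.in_arcsD2[OF assms] by (auto simp: uncolored_out_nbrs_def)
  then show ?thesis
    by (auto simp: forcing_set_def final_coloring_def elim: forcing_step.cases)
qed

lemma finite_orientations:
  assumes "pair_graph G"
  shows "finite {D. orientation_of D G}"
proof -
  interpret pair_graph G by fact
  have "{D. orientation_of D G} \<subseteq> (\<lambda>A. \<lparr>pverts = pverts G, parcs = A\<rparr>) ` Pow (parcs G)"
  proof
    fix D assume "D \<in> {D. orientation_of D G}"
    then have "D = \<lparr>pverts = pverts G, parcs = parcs D\<rparr>" "parcs D \<in> Pow (parcs G)"
      by (auto simp: orientation_of_def)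
    then show "D \<in> (\<lambda>A. \<lparr>pverts = pverts G, parcs = A\<rparr>) ` Pow (parcs G)"
      by (rule image_eqI)
  qed
  moreover have "finite (parcs G)" using finite_arcs by simp
  ultimately show ?thesis using finite_subset by blast
qed

lemma ex_orientation:
  assumes "pair_graph G"
  shows "\<exists>D. orientation_of D G"
proof -
  interpret pair_graph G by fact
  have "finite (pverts G)" using finite_verts by simp
  then obtain f :: "_ \<Rightarrow> nat" where f: "inj_on f (pverts G)"
    using finite_imp_inj_to_nat_seg by blast
  have "(v, u) \<in> parcs G \<and> f u \<noteq> f v" if "(u, v) \<in> parcs G" for u v
    using that f arcs_symmetric no_loops' in_arcsD1 in_arcsD2 by (metis inj_onD)
  then have "orientation_of \<lparr>pverts = pverts G, parcs = {(u, v) \<in> parcs G. f u < f v}\<rparr> G"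
    by (fastforce simp: orientation_of_def)
  then show ?thesis by blast
qed

end

theory Submission
  imports Defs
begin

text \<open>
  If a run in a tournament forces \<open>v\<^sub>1, \<dots>, v\<^sub>k\<close> in this order, using \<open>u\<^sub>1, \<dots>, u\<^sub>k\<close>, then \<open>v\<^sub>j\<close>
  is an in-neighbor of \<open>u\<^sub>i\<close> for all \<open>i < j\<close>. Hence \<open>k \<le> r + t\<close> if any \<open>r\<close> vertices have at
  most \<open>t\<close> common in-neighbors. For at most 40 vertices, subtournaments of quadratic residue
  tournaments (and one further tournament on 14 vertices) give \<open>k \<le> (n + 9) / 4\<close> in this way,
  with \<open>r = 2\<close> or \<open>r = 3\<close>. The quadratic residue tournament modulo 43 even gives \<open>k \<le> 9\<close>, so putting
  40 of its vertices in front of an arbitrary tournament adds at most \<open>9 + 1 = 40 / 4\<close> forcings,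
  and the bound follows for all \<open>n\<close> by induction in steps of 40.
\<close>

section \<open>Tournaments and forcing chains\<close>

definition tournament :: "'a set \<Rightarrow> ('a \<times> 'a) set \<Rightarrow> bool" where
  "tournament V A \<longleftrightarrow> A \<subseteq> V \<times> V \<and> (\<forall>u\<in>V. (u, u) \<notin> A) \<and>
     (\<forall>u\<in>V. \<forall>v\<in>V. u \<noteq> v \<longrightarrow> ((u, v) \<in> A) \<noteq> ((v, u) \<in> A))"

lemma tournamentI:
  assumes "A \<subseteq> V \<times> V" "\<And>u. (u, u) \<notin> A"
    and "\<And>u v. u \<in> V \<Longrightarrow> v \<in> V \<Longrightarrow> u \<noteq> v \<Longrightarrow> ((u, v) \<in> A) \<noteq> ((v, u) \<in> A)"
  shows "tournament V A"
  using assms unfolding tournament_def by blast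

lemma tournamentD:
  assumes "tournament V A"
  shows "A \<subseteq> V \<times> V" "(u, u) \<notin> A"
    and "u \<in> V \<Longrightarrow> v \<in> V \<Longrightarrow> u \<noteq> v \<Longrightarrow> ((u, v) \<in> A) \<noteq> ((v, u) \<in> A)"
  using assms unfolding tournament_def by blast+

lemma tournament_asym: "tournament V A \<Longrightarrow> (u, v) \<in> A \<Longrightarrow> (v, u) \<notin> A"
  unfolding tournament_def by (metis SigmaD1 SigmaD2 subsetD)

text \<open>
  The pairs (forcing vertex, forced vertex) of a run in chronological order; the forced vertices
  of later pairs are still uncolored, so in a tournament they must be in-neighbors.
\<close>

fun forcing_chain :: "('a \<times> 'a) set \<Rightarrow> ('a \<times> 'a) list \<Rightarrow> bool" where
  "forcing_chain A [] \<longleftrightarrow> True"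
| "forcing_chain A ((u, v) # ps) \<longleftrightarrow>
     (u, v) \<in> A \<and> (\<forall>w \<in> snd ` set ps. (w, u) \<in> A) \<and> forcing_chain A ps"

definition chains_le :: "('a \<times> 'a) set \<Rightarrow> nat \<Rightarrow> bool" where
  "chains_le A k \<longleftrightarrow> (\<forall>ps. forcing_chain A ps \<longrightarrow> length ps \<le> k)"

text \<open>For finite \<open>V\<close>, at most \<open>k\<close> vertices can be forced in such a
  tournament, so each of its forcing sets has at least \<open>card V - k\<close> elements.\<close>

definition has_tournament :: "'a set \<Rightarrow> nat \<Rightarrow> bool" where
  "has_tournament V k \<longleftrightarrow> (\<exists>A. tournament V A \<and> chains_le A k)"

lemma forcing_chain_arcs: "forcing_chain A ps \<Longrightarrow> set ps \<subseteq> A"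
  by (induction A ps rule: forcing_chain.induct) auto

lemma forcing_chain_mono: "forcing_chain A ps \<Longrightarrow> A \<subseteq> B \<Longrightarrow> forcing_chain B ps"
  by (induction A ps rule: forcing_chain.induct) auto

lemma forcing_chain_filter: "forcing_chain A ps \<Longrightarrow> forcing_chain A (filter P ps)"
  by (induction A ps rule: forcing_chain.induct) auto

lemma forcing_chain_restrict:
  "forcing_chain A ps \<Longrightarrow> \<forall>p\<in>set ps. fst p \<in> X \<and> snd p \<in> X \<Longrightarrow> forcing_chain (A \<inter> X \<times> X) ps"
  by (induction A ps rule: forcing_chain.induct) auto

lemma forcing_chain_append:
  "forcing_chain A (ps @ qs) \<Longrightarrow> p \<in> set ps \<Longrightarrow> q \<in> set qs \<Longrightarrow> (snd q, fst p) \<in> A"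
  by (induction ps) auto

text \<open>If \<open>u\<close> forced a second time, the vertex forced then would be an
  out-neighbor of \<open>u\<close>, but also an in-neighbor because of the first time. A vertex
  forced twice yields the same contradiction at the vertex forcing it first.\<close>

lemma forcing_chain_distinct:
  assumes "tournament V A" "forcing_chain A ps"
  shows "distinct (map fst ps)" "distinct (map snd ps)"
proof -
  have "distinct (map fst ps) \<and> distinct (map snd ps)"
    using assms(2)
  proof (induction ps)
    case (Cons p ps)
    obtain u v where p: "p = (u, v)" by force
    have "u \<notin> fst ` set ps"
    proof
      assume "u \<in> fst ` set ps"
      then obtain w where "(u, w) \<in> set ps" by force
      then have "(u, w) \<in> A" "(w, u) \<in> A"
        using Cons.prems p forcing_chain_arcs by fastforce+
      then show False using tournament_asym[OF assms(1)] by blast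
    qed
    moreover have "v \<notin> snd ` set ps"
      using Cons.prems p tournament_asym[OF assms(1)] by auto
    ultimately show ?case using Cons p by auto
  qed simp
  then show "distinct (map fst ps)" "distinct (map snd ps)" by auto
qed

section \<open>From forcing runs to lower bounds on \<open>MOF\<close>\<close>

text \<open>When \<open>u\<close> forces \<open>v\<close>, all vertices forced later are uncolored
  and different from \<open>v\<close>, so they are not out-neighbors of \<open>u\<close> and hence
  in-neighbors. Converse induction prepends pairs and so keeps the chain chronological.\<close>

lemma forcing_chain_of_steps:
  assumes "(forcing_step D)\<^sup>*\<^sup>* S C" "tournament (pverts D) (parcs D)" "C \<subseteq> pverts D"
  shows "\<exists>ps. forcing_chain (parcs D) ps \<and> C = S \<union> snd ` set ps \<and> snd ` set ps \<inter> S = {}"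
  using assms(1)
proof (induction rule: converse_rtranclp_induct)
  case base
  show ?case by (rule exI[of _ "[]"]) simp
next
  case (step S S')
  from step.hyps(1) obtain u v
    where u: "u \<in> S" "uncolored_out_nbrs D S u = {v}" "S' = insert v S"
    by (auto elim: forcing_step.cases)
  from step.IH obtain ps where ps: "forcing_chain (parcs D) ps" "C = S' \<union> snd ` set ps"
      "snd ` set ps \<inter> S' = {}"
    by blast
  have v: "(u, v) \<in> parcs D" "v \<notin> S"
    using u(2) by (auto simp: uncolored_out_nbrs_def)
  have "(w, u) \<in> parcs D" if w: "w \<in> snd ` set ps" for w
  proof -
    have "w \<notin> S" "w \<noteq> v" using w ps(3) u(3) by auto
    then have "(u, w) \<notin> parcs D" using u(2) by (auto simp: uncolored_out_nbrs_def)
    moreover have "u \<in> pverts D" "w \<in> pverts D" "u \<noteq> w"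
      using u w ps assms(3) by auto
    ultimately show ?thesis using assms(2) unfolding tournament_def by blast
  qed
  then have "forcing_chain (parcs D) ((u, v) # ps)" using v ps by auto
  moreover have "C = S \<union> snd ` set ((u, v) # ps)" "snd ` set ((u, v) # ps) \<inter> S = {}"
    using ps u v by auto
  ultimately show ?case by blast
qed

text \<open>A minimum forcing set together with the at most \<open>k\<close> vertices forced in its
  run covers \<open>pverts D\<close>.\<close>

lemma forcing_number_tournament:
  assumes "finite (pverts D)" "tournament (pverts D) (parcs D)" "chains_le (parcs D) k"
  shows "card (pverts D) \<le> forcing_number D + k"
proof -
  have "pair_wf_digraph D"
    using assms(2) by (auto simp: tournament_def pair_wf_digraph_def)
  then have "{S. forcing_set D S} \<noteq> {}" using forcing_set_pverts by blast
  then have "forcing_number D \<in> card ` {S. forcing_set D S}"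
    unfolding forcing_number_def using finite_forcing_sets[OF assms(1)] by (intro Min_in) auto
  then obtain S where S: "forcing_set D S" "forcing_number D = card S" by auto
  have "(forcing_step D)\<^sup>*\<^sup>* S (pverts D)"
    using S(1) by (simp add: forcing_set_def final_coloring_def)
  from forcing_chain_of_steps[OF this assms(2)] obtain ps
    where ps: "forcing_chain (parcs D) ps" "pverts D = S \<union> snd ` set ps" by blast
  have "card (pverts D) \<le> card S + card (snd ` set ps)"
    unfolding ps(2) by (rule card_Un_le)
  also have "card (snd ` set ps) \<le> length ps"
    by (metis card_length length_map set_map)
  also have "length ps \<le> k" using ps assms(3) by (simp add: chains_le_def)
  finally show ?thesis using S by simp
qed

lemma MOF_ge:
  assumes "complete_digraph n (with_proj G)" "has_tournament (pverts G) k"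
  shows "n \<le> MOF G + k"
proof -
  have G: "finite (pverts G)" "card (pverts G) = n"
      "parcs G = {(u, v). (u, v) \<in> pverts G \<times> pverts G \<and> u \<noteq> v}"
    using assms(1) by (auto simp: complete_digraph_pair_def)
  have "pair_graph G"
    using G finite_subset[of "parcs G" "pverts G \<times> pverts G"]
    by unfold_locales (auto simp: symmetric_def split: prod.splits intro: symI)
  obtain A where A: "tournament (pverts G) A" "chains_le A k"
    using assms(2) by (auto simp: has_tournament_def)
  define D where "D = \<lparr>pverts = pverts G, parcs = A\<rparr>"
  have "orientation_of D G"
    using A(1) unfolding orientation_of_def tournament_def D_def G(3) by auto
  then have "forcing_number D \<le> MOF G"
    unfolding MOF_def using finite_orientations[OF \<open>pair_graph G\<close>] by (intro Max_ge) auto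
  moreover have "n \<le> forcing_number D + k"
    using forcing_number_tournament[of D k] A G by (simp add: D_def)
  ultimately show ?thesis by linarith
qed

section \<open>Subtournaments, relabeling and composition\<close>

lemma has_tournament_mono: "has_tournament V k \<Longrightarrow> k \<le> l \<Longrightarrow> has_tournament V l"
  unfolding has_tournament_def chains_le_def by (meson le_trans)

lemma has_tournament_subset:
  assumes "has_tournament V k" "W \<subseteq> V"
  shows "has_tournament W k"
proof -
  obtain A where A: "tournament V A" "chains_le A k"
    using assms(1) by (auto simp: has_tournament_def)
  have "tournament W (A \<inter> W \<times> W)"
    using A(1) assms(2) unfolding tournament_def by blast
  moreover have "chains_le (A \<inter> W \<times> W) k"
    using A(2) forcing_chain_mono unfolding chains_le_def by (metis inf_le1)
  ultimately show ?thesis by (auto simp: has_tournament_def)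
qed

lemma has_tournament_image:
  assumes "has_tournament V k" "inj_on f V"
  shows "has_tournament (f ` V) k"
proof -
  obtain A where A: "tournament V A" "chains_le A k"
    using assms(1) by (auto simp: has_tournament_def)
  define g where "g = inv_into V f"
  have g: "g (f x) = x" if "x \<in> V" for x
    using assms(2) that by (simp add: g_def)
  define B where "B = {(x, y). x \<in> f ` V \<and> y \<in> f ` V \<and> (g x, g y) \<in> A}"
  have "tournament (f ` V) B"
    using A(1) g unfolding tournament_def B_def by auto
  moreover have "forcing_chain A (map (map_prod g g) ps)" if "forcing_chain B ps" for ps
    using that by (induction ps) (auto simp: B_def)
  then have "chains_le B k"
    using A(2) unfolding chains_le_def by fastforce
  ultimately show ?thesis by (auto simp: has_tournament_def)
qed

text \<open>Only the number of vertices matters, so tournaments on integer intervals serve for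
  vertex sets of any type.\<close>

lemma has_tournament_card_le:
  assumes "has_tournament V k" "finite V" "finite W" "card W \<le> card V"
  shows "has_tournament W k"
proof -
  obtain U where "U \<subseteq> V" "card U = card W"
    using assms(4) obtain_subset_with_card_n by metis
  moreover obtain f where "bij_betw f U W"
    using calculation assms finite_same_card_bij finite_subset by metis
  ultimately show ?thesis
    using has_tournament_subset[OF assms(1)] has_tournament_image
    by (metis bij_betw_imp_inj_on bij_betw_imp_surj_on)
qed

text \<open>
  Orienting all arcs from \<open>X\<close> to \<open>Y\<close>: a forcing from \<open>X\<close> into \<open>Y\<close> can only happen when
  a single vertex of \<open>Y\<close> is uncolored, hence at most once.
\<close>

lemma has_tournament_Un:
  assumes "has_tournament X k" "has_tournament Y l" "X \<inter> Y = {}"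
  shows "has_tournament (X \<union> Y) (k + l + 1)"
proof -
  obtain A where A: "tournament X A" "chains_le A k"
    using assms(1) by (auto simp: has_tournament_def)
  obtain B where B: "tournament Y B" "chains_le B l"
    using assms(2) by (auto simp: has_tournament_def)
  define C where "C = A \<union> B \<union> X \<times> Y"
  have sub: "A \<subseteq> X \<times> X" "B \<subseteq> Y \<times> Y"
    using A(1) B(1) by (auto simp: tournament_def)
  have C: "tournament (X \<union> Y) C"
  proof (rule tournamentI)
    show "C \<subseteq> (X \<union> Y) \<times> (X \<union> Y)" using sub by (auto simp: C_def)
    show "(u, u) \<notin> C" for u
      using tournamentD(2)[OF A(1)] tournamentD(2)[OF B(1)] assms(3) by (auto simp: C_def)
    fix u v assume "u \<in> X \<union> Y" "v \<in> X \<union> Y" "u \<noteq> v"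
    then consider "u \<in> X" "v \<in> X" | "u \<in> Y" "v \<in> Y" | "u \<in> X" "v \<in> Y" | "u \<in> Y" "v \<in> X"
      by blast
    then show "((u, v) \<in> C) \<noteq> ((v, u) \<in> C)"
    proof cases
      case 1
      then show ?thesis
        using tournamentD(3)[OF A(1) 1 \<open>u \<noteq> v\<close>] sub assms(3) by (auto simp: C_def)
    next
      case 2
      then show ?thesis
        using tournamentD(3)[OF B(1) 2 \<open>u \<noteq> v\<close>] sub assms(3) by (auto simp: C_def)
    qed (use sub assms(3) in \<open>auto simp: C_def\<close>)
  qed
  have CX: "C \<inter> X \<times> X = A" and CY: "C \<inter> Y \<times> Y = B"
    using sub assms(3) by (auto simp: C_def)
  have "length ps \<le> k + l + 1" if ps: "forcing_chain C ps" for ps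
  proof -
    let ?P = "\<lambda>p. fst p \<in> X \<and> snd p \<in> X" and ?Q = "\<lambda>p. fst p \<in> Y \<and> snd p \<in> Y"
      and ?R = "\<lambda>p. fst p \<in> X \<and> snd p \<in> Y"
    have "forcing_chain A (filter ?P ps)"
      unfolding CX[symmetric] by (intro forcing_chain_restrict forcing_chain_filter ps) auto
    then have P: "length (filter ?P ps) \<le> k" using A(2) by (simp add: chains_le_def)
    have "forcing_chain B (filter ?Q ps)"
      unfolding CY[symmetric] by (intro forcing_chain_restrict forcing_chain_filter ps) auto
    then have Q: "length (filter ?Q ps) \<le> l" using B(2) by (simp add: chains_le_def)
    have R: "length (filter ?R ps) \<le> 1"
    proof (rule ccontr)
      assume "\<not> ?thesis"
      then obtain p q rs where eq: "filter ?R ps = p # q # rs"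
        by (auto simp: not_le less_eq_Suc_le Suc_le_length_iff)
      have "forcing_chain C ([p] @ q # rs)"
        using forcing_chain_filter[OF ps, of ?R] eq by simp
      \<comment> \<open>The vertex forced by the later pair \<open>q\<close> lies in
        \<open>Y\<close> and would need an arc into \<open>X\<close>.\<close>
      then have "(snd q, fst p) \<in> C" by (rule forcing_chain_append) auto
      moreover have "p \<in> set (filter ?R ps)" "q \<in> set (filter ?R ps)" using eq by auto
      ultimately show False using sub assms(3) by (auto simp: C_def)
    qed
    have "set ps \<subseteq> C" using ps by (rule forcing_chain_arcs)
    \<comment> \<open>No arc leads from \<open>Y\<close> to \<open>X\<close>, so the three kinds of
      pairs exhaust the chain.\<close>
    then have "length ps = length (filter ?P ps) + length (filter ?Q ps) + length (filter ?R ps)"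
    proof (induction ps)
      case (Cons p ps)
      then have "?P p \<or> ?Q p \<or> ?R p" using sub by (auto simp: C_def)
      then show ?case using Cons assms(3) by auto
    qed simp
    then show ?thesis using P Q R by linarith
  qed
  then show ?thesis using C by (auto simp: has_tournament_def chains_le_def)
qed

section \<open>Bounding chains by common in-neighbors\<close>

text \<open>The first \<open>r\<close> forcing vertices are distinct, and everything forced after
  these \<open>r\<close> steps is a common in-neighbor of them.\<close>

lemma chains_le_common_in_nbrs:
  assumes "tournament V A" "finite V"
    and common: "\<And>U. U \<subseteq> V \<Longrightarrow> card U = r \<Longrightarrow> card {w \<in> V. \<forall>u\<in>U. (w, u) \<in> A} \<le> t"
  shows "chains_le A (r + t)"
  unfolding chains_le_def
proof (intro allI impI)
  fix ps assume ps: "forcing_chain A ps"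
  show "length ps \<le> r + t"
  proof (cases "r \<le> length ps")
    case True
    define U where "U = fst ` set (take r ps)"
    define W where "W = snd ` set (drop r ps)"
    have arcs: "set ps \<subseteq> V \<times> V"
      using forcing_chain_arcs[OF ps] assms(1) by (auto simp: tournament_def)
    have dist: "distinct (map fst (take r ps))" "distinct (map snd (drop r ps))"
      using forcing_chain_distinct[OF assms(1) ps] by (simp_all flip: take_map drop_map)
    have "card U = r"
      using distinct_card[OF dist(1)] True by (simp add: U_def)
    moreover have "U \<subseteq> V"
      using arcs by (auto simp: U_def dest!: in_set_takeD)
    moreover have "W \<subseteq> {w \<in> V. \<forall>u\<in>U. (w, u) \<in> A}"
      using arcs forcing_chain_append[of A "take r ps" "drop r ps"] ps
      by (fastforce simp: U_def W_def dest: in_set_dropD)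
    ultimately have "card W \<le> t"
      using common[of U] card_mono[of "{w \<in> V. \<forall>u\<in>U. (w, u) \<in> A}" W] assms(2) le_trans
      by simp
    moreover have "card W = length ps - r"
      using distinct_card[OF dist(2)] by (simp add: W_def)
    ultimately show ?thesis using True by linarith
  qed simp
qed

text \<open>Executable search over the ways to pick \<open>r\<close> entries of \<open>us\<close>;
  \<open>W\<close> holds the candidates with arcs to all entries picked so far. Since
  \<open>W\<close> only shrinks, a branch is cut once \<open>length W\<close> is at most
  \<open>t\<close>.\<close>

fun common_le :: "('a \<Rightarrow> 'a \<Rightarrow> bool) \<Rightarrow> nat \<Rightarrow> nat \<Rightarrow> 'a list \<Rightarrow> 'a list \<Rightarrow> bool" where
  "common_le a t 0 W us \<longleftrightarrow> length W \<le> t"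
| "common_le a t (Suc r) W [] \<longleftrightarrow> True"
| "common_le a t (Suc r) W (u # us) \<longleftrightarrow> length W \<le> t \<or>
     common_le a t r (filter (\<lambda>w. a w u) W) us \<and> common_le a t (Suc r) W us"

text \<open>Either \<open>U\<close> contains the head \<open>u\<close>, and filtering
  \<open>W\<close> reduces the claim to \<open>U - {u}\<close>, or \<open>U\<close> lies in the
  tail.\<close>

lemma common_le_card:
  assumes "common_le a t r W us" "U \<subseteq> set us" "card U = r"
  shows "card {w \<in> set W. \<forall>u\<in>U. a w u} \<le> t"
proof -
  have short: "card {w \<in> set W. \<forall>u\<in>U. a w u} \<le> t" if "length W \<le> t"
    for a t W and U :: "'a set"
    using that card_mono[of "set W" "{w \<in> set W. \<forall>u\<in>U. a w u}"] card_length[of W] by force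
  show ?thesis
    using assms
  proof (induction a t r W us arbitrary: U rule: common_le.induct)
    case (1 a t W us)
    then show ?case using short by simp
  next
    case (2 a t r W)
    then show ?case by simp
  next
    case (3 a t r W u us)
    have fin: "finite U" using "3.prems"(3) by (metis card.infinite nat.distinct(1))
    show ?case
    proof (cases "length W \<le> t")
      case True
      then show ?thesis by (rule short)
    next
      case False
      show ?thesis
      proof (cases "u \<in> U")
        case True
        have "{w \<in> set W. \<forall>u\<in>U. a w u}
            = {w \<in> set (filter (\<lambda>w. a w u) W). \<forall>u \<in> U - {u}. a w u}"
          using True by auto
        then show ?thesis
          using "3.IH"(1)[of "U - {u}"] "3.prems" False True fin by auto
      next
        case False
        then show ?thesis
          using "3.IH"(2)[of U] "3.prems" \<open>\<not> length W \<le> t\<close> by auto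
      qed
    qed
  qed
qed

section \<open>Circulant and quadratic residue tournaments\<close>

definition residue_arc :: "int \<Rightarrow> int list \<Rightarrow> int \<Rightarrow> int \<Rightarrow> bool" where
  "residue_arc p Q w u \<longleftrightarrow> (u - w) mod p \<in> set Q"

text \<open>Half of the range suffices because \<open>x\<close> and \<open>- x\<close> have the same
  square. For a prime \<open>p\<close> congruent to 3 modulo 4, -1 is not a square, so exactly one
  of \<open>d\<close> and \<open>p - d\<close> is listed for 0 < \<open>d\<close> <
  \<open>p\<close>; the result is the Paley tournament.\<close>

definition squares :: "int \<Rightarrow> int list" where
  "squares p = map (\<lambda>x. x * x mod p) [1..(p - 1) div 2]"

text \<open>
  By translation invariance, it suffices to check vertex sets that contain 0.
\<close>

lemma has_tournament_residue:
  fixes p :: int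
  assumes "0 \<notin> set Q" "list_all (\<lambda>d. (d \<in> set Q) \<noteq> (p - d \<in> set Q)) [1..p - 1]"
    and check: "common_le (residue_arc p Q) t r
      (filter (\<lambda>w. residue_arc p Q w 0) [0..p - 1]) [1..p - 1]"
    and "k = Suc r + t"
  shows "has_tournament {0..<p} k"
proof -
  define A where "A = {(w, u). w \<in> {0..<p} \<and> u \<in> {0..<p} \<and> residue_arc p Q w u}"
  \<comment> \<open>For \<open>u < v\<close> the two differences are \<open>d\<close> and
    \<open>p - d\<close> with \<open>d\<close> in \<open>[1..p - 1]\<close>; the other case is
    symmetric.\<close>
  have lt: "residue_arc p Q u v \<noteq> residue_arc p Q v u"
    if "u \<in> {0..<p}" "v \<in> {0..<p}" "u < v" for u v
  proof -
    have "(v - u) mod p = v - u" using that by simp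
    moreover have "(u - v) mod p = p - (v - u)"
      using that mod_pos_pos_trivial[of "u - v + p" p] by simp
    moreover have "v - u \<in> set [1..p - 1]" using that by simp
    ultimately show ?thesis
      using assms(2) unfolding residue_arc_def list_all_iff by metis
  qed
  have neq: "residue_arc p Q u v \<noteq> residue_arc p Q v u"
    if "u \<in> {0..<p}" "v \<in> {0..<p}" "u \<noteq> v" for u v
    using lt[of u v] lt[of v u] that by (cases u v rule: linorder_cases) auto
  have A: "tournament {0..<p} A"
  proof (rule tournamentI)
    show "((u, v) \<in> A) \<noteq> ((v, u) \<in> A)"
      if "u \<in> {0..<p}" "v \<in> {0..<p}" "u \<noteq> v" for u v
      using neq[OF that] that by (simp add: A_def)
  qed (use assms(1) in \<open>auto simp: A_def residue_arc_def\<close>)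
  have "chains_le A (Suc r + t)"
  proof (rule chains_le_common_in_nbrs[OF A])
    show "finite {0..<p}" by simp
    fix U assume U: "U \<subseteq> {0..<p}" "card U = Suc r"
    obtain u0 where u0: "u0 \<in> U" using U(2) by fastforce
    \<comment> \<open>This translation preserves arcs and sends \<open>u0\<close> to 0, which
      accounts for one of the \<open>Suc r\<close> vertices; the check picks the other
      \<open>r\<close> among the nonzero residues.\<close>
    define \<tau> where "\<tau> x = (x - u0) mod p" for x
    have p: "p > 0" using u0 U(1) by auto
    have inj: "inj_on \<tau> {0..<p}"
    proof
      fix x y assume "x \<in> {0..<p}" "y \<in> {0..<p}" "\<tau> x = \<tau> y"
      then have "(x - u0 + u0) mod p = (y - u0 + u0) mod p"
        unfolding \<tau>_def by (metis mod_add_left_eq)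
      then show "x = y" using \<open>x \<in> _\<close> \<open>y \<in> _\<close> by simp
    qed
    have arc: "residue_arc p Q (\<tau> w) (\<tau> u) = residue_arc p Q w u" for w u
      by (simp add: residue_arc_def \<tau>_def mod_simps)
    define U' where "U' = \<tau> ` (U - {u0})"
    have "\<tau> u0 = 0" by (simp add: \<tau>_def)
    have \<tau>: "\<tau> x \<in> {0..<p}" for x using p by (simp add: \<tau>_def)
    have "\<tau> x \<in> set [1..p - 1]" if "x \<in> U - {u0}" for x
    proof -
      have "\<tau> x \<noteq> 0"
        using that inj U(1) u0 \<open>\<tau> u0 = 0\<close> by (metis Diff_iff inj_onD insertI1 subsetD)
      then show ?thesis using \<tau>[of x] by simp
    qed
    then have "U' \<subseteq> set [1..p - 1]" unfolding U'_def by (rule image_subsetI)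
    moreover have "card U' = r"
      unfolding U'_def using U u0 inj_on_subset[OF inj, of "U - {u0}"] by (subst card_image) auto
    ultimately have W: "card {w \<in> set (filter (\<lambda>w. residue_arc p Q w 0) [0..p - 1]).
        \<forall>u\<in>U'. residue_arc p Q w u} \<le> t" (is "card ?W \<le> t")
      by (rule common_le_card[OF check])
    have sub: "\<tau> ` {w \<in> {0..<p}. \<forall>u\<in>U. (w, u) \<in> A} \<subseteq> ?W"
    proof (intro image_subsetI)
      fix w assume w: "w \<in> {w \<in> {0..<p}. \<forall>u\<in>U. (w, u) \<in> A}"
      then have "residue_arc p Q (\<tau> w) (\<tau> u)" if "u \<in> U" for u
        using that arc by (simp add: A_def)
      moreover from this[OF u0] have "residue_arc p Q (\<tau> w) 0"
        using \<open>\<tau> u0 = 0\<close> by simp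
      ultimately show "\<tau> w \<in> ?W" using \<tau>[of w] by (auto simp: U'_def)
    qed
    have "card {w \<in> {0..<p}. \<forall>u\<in>U. (w, u) \<in> A}
        = card (\<tau> ` {w \<in> {0..<p}. \<forall>u\<in>U. (w, u) \<in> A})"
      by (intro card_image[symmetric] inj_on_subset[OF inj]) auto
    also have "\<dots> \<le> card ?W" 
      by (rule card_mono[OF finite_subset[of _ "set [0..p - 1]"] sub]) auto
    also have "\<dots> \<le> t" by (rule W)
    finally show "card {w \<in> {0..<p}. \<forall>u\<in>U. (w, u) \<in> A} \<le> t" .
  qed
  then show ?thesis using A assms(4) by (auto simp: has_tournament_def)
qed

section \<open>Tournaments on few vertices\<close>

text \<open>Here \<open>r\<close> does not count the vertex 0. For 3, 7, 11 and 19, any two vertices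
  have \<open>(p - 3) div 4\<close> common in-neighbors, which is \<open>t\<close>; for 31 and 43,
  triples give a smaller bound than pairs.\<close>

lemma has_tournament_3: "has_tournament {0..<3 :: int} 2"
  by (rule has_tournament_residue[where Q = "squares 3" and r = 1 and t = 0]; code_simp)

lemma has_tournament_7: "has_tournament {0..<7 :: int} 3"
  by (rule has_tournament_residue[where Q = "squares 7" and r = 1 and t = 1]; code_simp)

lemma has_tournament_11: "has_tournament {0..<11 :: int} 4"
  by (rule has_tournament_residue[where Q = "squares 11" and r = 1 and t = 2]; code_simp)

lemma has_tournament_19: "has_tournament {0..<19 :: int} 6"
  by (rule has_tournament_residue[where Q = "squares 19" and r = 1 and t = 4]; code_simp)

lemma has_tournament_31: "has_tournament {0..<31 :: int} 7"
  by (rule has_tournament_residue[where Q = "squares 31" and r = 2 and t = 4]; code_simp)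

lemma has_tournament_43: "has_tournament {0..<43 :: int} 9"
  by (rule has_tournament_residue[where Q = "squares 43" and r = 2 and t = 6]; code_simp)

text \<open>
  Two copies of the quadratic residue tournament modulo 7, the second one reversed: the
  doubling construction for skew Hadamard matrices without its extra vertex.
\<close>

definition double_arc :: "int \<Rightarrow> int \<Rightarrow> bool" where
  "double_arc w u \<longleftrightarrow> (u - w) mod 7 \<in>
     (if u < 7 then if w < 7 then {1, 2, 4} else {0, 1, 2, 4}
      else if w < 7 then {1, 2, 4} else {3, 5, 6})"

text \<open>Needed for 12 to 14 vertices: the tournament on 11 vertices is too small, and the bound
  6 of the one on 19 exceeds \<open>(n + 9) div 4\<close>. Translations modulo 7 do not exchange the
  two copies, so all pairs are checked.\<close>

lemma has_tournament_14: "has_tournament {0..<14 :: int} 5"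
proof -
  define A where "A = {(w, u). w \<in> {0..<14} \<and> u \<in> {0..<14} \<and> double_arc w u}"
  have set: "set [0..13] = {0..<14 :: int}" by auto
  have "\<forall>u\<in>set [0..13]. \<forall>v\<in>set [0..13]. u \<noteq> v \<longrightarrow> double_arc u v \<noteq> double_arc v u"
    by code_simp
  then have neq: "double_arc u v \<noteq> double_arc v u"
    if "u \<in> {0..<14}" "v \<in> {0..<14}" "u \<noteq> v" for u v
    using that unfolding set by blast
  have A: "tournament {0..<14} A"
  proof (rule tournamentI)
    show "((u, v) \<in> A) \<noteq> ((v, u) \<in> A)"
      if "u \<in> {0..<14}" "v \<in> {0..<14}" "u \<noteq> v" for u v
      using neq[OF that] that by (simp add: A_def)
  qed (auto simp: A_def double_arc_def)
  have check: "common_le double_arc 3 2 [0..13] [0..13]"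
    by code_simp
  have "chains_le A (2 + 3)"
  proof (rule chains_le_common_in_nbrs[OF A])
    show "finite {0..<14 :: int}" by simp
    fix U :: "int set" assume U: "U \<subseteq> {0..<14}" "card U = 2"
    have "{w \<in> {0..<14}. \<forall>u\<in>U. (w, u) \<in> A} = {w \<in> set [0..13]. \<forall>u\<in>U. double_arc w u}"
      using U(1) unfolding set by (auto simp: A_def)
    then show "card {w \<in> {0..<14}. \<forall>u\<in>U. (w, u) \<in> A} \<le> 3"
      using common_le_card[OF check, of U] U set by simp
  qed
  then show ?thesis using A by (auto simp: has_tournament_def)
qed

section \<open>Covering all sizes by induction\<close>

lemma has_tournament_quarter:
  assumes "finite V"
  shows "has_tournament V ((card V + 9) div 4)"
  using assms
proof (induction "card V" arbitrary: V rule: less_induct)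
  case less
  have *: "has_tournament V ((card V + 9) div 4)"
    if "has_tournament {0..<m :: int} k" "card V \<le> nat m" "k \<le> (card V + 9) div 4" for m k
    using has_tournament_mono[OF has_tournament_card_le[OF that(1)] that(3)] that(2) less.prems
    by simp
  \<comment> \<open>Via subtournaments, a bound \<open>k\<close> on \<open>m\<close> vertices serves
    every size from \<open>4 * k - 9\<close> to \<open>m\<close>, which gives these ranges; the one
    for 43 vertices is cut at 40, the step of the induction.\<close>
  consider "card V \<le> 3" | "3 \<le> card V" "card V \<le> 7" | "7 \<le> card V" "card V \<le> 11"
    | "11 \<le> card V" "card V \<le> 14" | "15 \<le> card V" "card V \<le> 19"
    | "19 \<le> card V" "card V \<le> 31" | "27 \<le> card V" "card V \<le> 40" | "card V > 40"
    by linarith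
  then show ?case
  proof cases
    case 1
    then show ?thesis by (intro *[OF has_tournament_3]) auto
  next
    case 2
    then show ?thesis by (intro *[OF has_tournament_7]) auto
  next
    case 3
    then show ?thesis by (intro *[OF has_tournament_11]) auto
  next
    case 4
    then show ?thesis by (intro *[OF has_tournament_14]) auto
  next
    case 5
    then show ?thesis by (intro *[OF has_tournament_19]) auto
  next
    case 6
    then show ?thesis by (intro *[OF has_tournament_31]) auto
  next
    case 7
    then show ?thesis by (intro *[OF has_tournament_43]) auto
  next
    case 8
    obtain X where X: "X \<subseteq> V" "card X = 40" "finite X"
      using 8 obtain_subset_with_card_n[of 40 V] by auto
    have card: "card (V - X) = card V - 40"
      using X by (simp add: card_Diff_subset)
    have "has_tournament (V - X) ((card V - 40 + 9) div 4)"
      using less.hyps[of "V - X"] less.prems card 8 by simp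
    moreover have "has_tournament X 9"
      by (rule has_tournament_card_le[OF has_tournament_43]) (use X in auto)
    ultimately have "has_tournament (X \<union> (V - X)) (9 + (card V - 40 + 9) div 4 + 1)"
      by (intro has_tournament_Un) auto
    moreover have "9 + (card V - 40 + 9) div 4 + 1 = (card V + 9) div 4"
      using 8 by linarith
    moreover have "X \<union> (V - X) = V" using X by auto
    ultimately show ?thesis by simp
  qed
qed

theorem theorem6:
  fixes n :: nat and G :: "'a pair_pre_digraph"
  assumes "n > 0"
    and "complete_digraph n (with_proj G)"
  shows "real (MOF G) \<ge> (3 * real n - 9) / 4"
proof -
  have "finite (pverts G)" "card (pverts G) = n"
    using assms(2) by (auto simp: complete_digraph_pair_def)
  then have "has_tournament (pverts G) ((n + 9) div 4)"
    using has_tournament_quarter by blast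
  then have "n \<le> MOF G + (n + 9) div 4" by (rule MOF_ge[OF assms(2)])
  \<comment> \<open>Multiplying by 4 removes the rounding, as \<open>4 * ((n + 9) div 4)\<close> is
    at most \<open>n + 9\<close>.\<close>
  then have "3 * n \<le> 4 * MOF G + 9" by linarith
  then have "real (3 * n) \<le> real (4 * MOF G + 9)" by (rule of_nat_mono)
  then show ?thesis by simp
qed

end
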